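(* If $T$ is an arithmetic rank-one transformation, then $T$ is weak doubly ergodic.
   Context: A column is an ordered finite collection of pairwise disjoint intervals in $\mathbb R$ of equal length (its levels), thought of as stacked, with heights indexed from $0$; its column map $T_C$ sends each point of a level other than the top one to the point directly above it in the next level. A rank-one (cutting-and-stacking) transformation $T$ is given by columns $C_0,C_1,C_2,\dots$ as follows: $C_0$ is the single level consisting of the unit interval; $C_{n+1}$ is obtained from $C_n$ by cutting $C_n$ into $r_n\ge 2$ subcolumns of equal width, numbered $0,\dots,r_n-1$ from left to right, adding $s_{n,k}\ge 0$ new levels (spacers: intervals of the same length as the subcolumn levels, disjoint from $C_n$ and from each other) above the $k$-th subcolumn, and stacking each subcolumn (with its spacers) under the subcolumn to its right. $X$ is the union of all levels of all columns, $\mu$ is Lebesgue measure on $X$, and $T$ is the pointwise limit of the $T_{C_n}$; it is an invertible (mod null sets) measure-preserving transformation. It is assumed that $\mu(X)=\infty$. Let $h_n$ be the number of levels of $C_n$. The $n$-th height set is $$H_n=\{0\}\cup\Big\{\sum_{k=0}^{\ell}(h_n+s_{n,k}) : 0\le \ell<r_n-1\Big\},$$ so $|H_n|=r_n$. A rank-one transformation $T$ is an arithmetic rank-one transformation if there are an infinite sequence of (distinct) indices $n_i\to\infty$ ($i\in\mathbb N$), nonnegative integers $a_{n_i}$, integers $k_{n_i}\ge 1$, positive integers $s_{n_i}$ and a constant $\tau>0$ such that for every $i$ the height set $H_{n_i}$ contains the set $$S_{n_i}=\Big\{a_{n_i}+j\,h_{n_i}+\sum_{q=1}^{j}(k_{n_i}+q)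 : 0\le j\le s_{n_i}-1\Big\}$$ (that is, the set with elements $a_{n_i},\ a_{n_i}+h_{n_i}+k_{n_i}+1,\ a_{n_i}+2h_{n_i}+2k_{n_i}+3,\ \dots$), $\frac{s_{n_i}}{r_{n_i}}>\tau$ for all $i$, and the sequence $(r_{n_i})_i$ is unbounded (and $r_n\ge 2$ for all $n$). $T$ is weak doubly ergodic if for every pair of measurable sets $A,B$ of positive measure there is a positive integer $n$ with $\mu(A\cap T^{-n}A)>0$ and $\mu(B\cap T^{-n}A)>0$. *)

theory Defs
  imports "HOL-Analysis.Analysis"
begin

text \<open>
  Intervals are taken left-closed and right-open, so that cutting an interval into subintervals
  is an exact partition. A column is given by the common length of its levels and the list of
  their left endpoints, from bottom (height 0) to top.
\<close>

record column =
  lvl_length :: real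
  lefts :: "real list"

definition height :: "column \<Rightarrow> nat" where
  "height C = length (lefts C)"

definition level :: "column \<Rightarrow> nat \<Rightarrow> real set" where
  "level C j = {lefts C ! j ..< lefts C ! j + lvl_length C}"

definition column_union :: "column \<Rightarrow> real set" where
  "column_union C = (\<Union>j<height C. level C j)"

definition disjoint_levels :: "column \<Rightarrow> bool" where
  "disjoint_levels C \<longleftrightarrow> disjoint_family_on (level C) {..<height C}"

definition column_map :: "column \<Rightarrow> real \<Rightarrow> real option" where
  "column_map C x =
    (if \<exists>j. j + 1 < height C \<and> x \<in> level C j
     then (let j = (THE j. j + 1 < height C \<and> x \<in> level C j)
           in Some (lefts C ! (j + 1) + (x - lefts C ! j)))
     else None)"

definition unit_column :: column where
  "unit_column = \<lparr>lvl_length = 1, lefts = [0]\<rparr>"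

definition subcolumn :: "column \<Rightarrow> nat \<Rightarrow> nat \<Rightarrow> column" where
  "subcolumn C r k =
    \<lparr>lvl_length = lvl_length C / real r,
     lefts = map (\<lambda>a. a + real k * (lvl_length C / real r)) (lefts C)\<rparr>"

text \<open>
  The list \<open>sp k\<close> consists of the left endpoints of the spacers placed above the \<open>k\<close>-th subcolumn;
  their position in the real line is arbitrary apart from disjointness.
\<close>

definition cut_and_stack :: "nat \<Rightarrow> (nat \<Rightarrow> nat) \<Rightarrow> column \<Rightarrow> column \<Rightarrow> bool" where
  "cut_and_stack r s C C' \<longleftrightarrow>
    (\<exists>sp :: nat \<Rightarrow> real list.
      (let Sp = \<lparr>lvl_length = lvl_length C / real r, lefts = concat (map sp [0..<r])\<rparr>
       in (\<forall>k<r. length (sp k) = s k) \<and>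
          disjoint_levels Sp \<and>
          column_union Sp \<inter> column_union C = {} \<and>
          C' = \<lparr>lvl_length = lvl_length C / real r,
                lefts = concat (map (\<lambda>k. lefts (subcolumn C r k) @ sp k) [0..<r])\<rparr>))"

definition rank_one_space :: "(nat \<Rightarrow> column) \<Rightarrow> real set" where
  "rank_one_space C = (\<Union>n. column_union (C n))"

definition rank_one_measure :: "(nat \<Rightarrow> column) \<Rightarrow> real measure" where
  "rank_one_measure C = lebesgue_on (rank_one_space C)"

text \<open>
  With half-open levels, every point of the space lies below the top level of \<open>C n\<close> for all
  large \<open>n\<close>, and the column maps extend one another; so on the space the sequence below is
  eventually constant, and it is only outside the space that the value is meaningless.
\<close>

definition rank_one_map :: "(nat \<Rightarrow> column) \<Rightarrow> real \<Rightarrow> real" where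
  "rank_one_map C x = lim (\<lambda>n. the (column_map (C n) x))"

locale rank_one =
  fixes r :: "nat \<Rightarrow> nat" and s :: "nat \<Rightarrow> nat \<Rightarrow> nat" and C :: "nat \<Rightarrow> column"
  assumes cuts: "\<And>n. r n \<ge> 2"
    and base: "C 0 = unit_column"
    and step: "\<And>n. cut_and_stack (r n) (s n) (C n) (C (Suc n))"
    and infinite_measure: "emeasure (rank_one_measure C) (rank_one_space C) = \<infinity>"

definition height_set :: "(nat \<Rightarrow> nat) \<Rightarrow> (nat \<Rightarrow> nat \<Rightarrow> nat) \<Rightarrow> (nat \<Rightarrow> column) \<Rightarrow> nat \<Rightarrow> nat set" where
  "height_set r s C n = {0} \<union> {(\<Sum>k=0..l. (height (C n) + s n k)) | l. l < r n - 1}"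

definition staircase_set :: "nat \<Rightarrow> nat \<Rightarrow> nat \<Rightarrow> nat \<Rightarrow> nat set" where
  "staircase_set h a k m = {a + j * h + (\<Sum>q=1..j. (k + q)) | j. j \<le> m - 1}"

definition arithmetic_rank_one ::
    "(nat \<Rightarrow> nat) \<Rightarrow> (nat \<Rightarrow> nat \<Rightarrow> nat) \<Rightarrow> (nat \<Rightarrow> column) \<Rightarrow> bool" where
  "arithmetic_rank_one r s C \<longleftrightarrow> rank_one r s C \<and>
    (\<exists>(idx :: nat \<Rightarrow> nat) (a :: nat \<Rightarrow> nat) (k :: nat \<Rightarrow> nat) (m :: nat \<Rightarrow> nat) (\<tau> :: real).
      inj idx \<and> filterlim idx at_top sequentially \<and> \<tau> > 0 \<and>
      (\<forall>i. k (idx i) \<ge> 1 \<and> m (idx i) \<ge> 1 \<and>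
           staircase_set (height (C (idx i))) (a (idx i)) (k (idx i)) (m (idx i))
             \<subseteq> height_set r s C (idx i) \<and>
           real (m (idx i)) / real (r (idx i)) > \<tau>) \<and>
      \<not> bdd_above (range (\<lambda>i. r (idx i))))"

definition weak_doubly_ergodic :: "'a measure \<Rightarrow> ('a \<Rightarrow> 'a) \<Rightarrow> bool" where
  "weak_doubly_ergodic M T \<longleftrightarrow>
    (\<forall>A\<in>sets M. \<forall>B\<in>sets M. emeasure M A > 0 \<longrightarrow> emeasure M B > 0 \<longrightarrow>
      (\<exists>n>0. emeasure M (A \<inter> ((T ^^ n) -` A \<inter> space M)) > 0 \<and>
             emeasure M (B \<inter> ((T ^^ n) -` A \<inter> space M)) > 0))"

end

theory Submission
  imports Defs
begin

text \<open>
  Call the fraction of a level that \<open>A\<close> misses the deficit of \<open>A\<close> in that level. Every late column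
  has levels \<open>I\<close> and \<open>J\<close> in which \<open>A\<close> and \<open>B\<close> have small deficits. By averaging over subcolumns,
  later columns have such a pair with the same height difference \<open>d\<close>, so we may pass to a column
  whose staircase is much longer than \<open>\<bar>d\<bar>\<close>. Consecutive gaps of the staircase increase by exactly
  one, hence the time that carries the \<open>t\<close>-th staircase copy of \<open>I\<close> to the next one also carries the
  \<open>(t + d)\<close>-th copy of \<open>J\<close> to the \<open>(t + d + 1)\<close>-th copy of \<open>I\<close>. The staircase contains a fixed
  proportion of all copies, so for some \<open>t\<close> the deficits in each of the two pairs of copies
  add up to less than one, and both overlaps have positive measure.
\<close>

subsection \<open>Indices into concatenated blocks\<close>

lemma length_concat_map_upt:
  "length (concat (map f [0..<r])) = (\<Sum>k<r. length (f k))"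
  by (induction r) auto

lemma nth_concat_map_upt:
  assumes "p < r" "j < length (f p)"
  shows "concat (map f [0..<r]) ! ((\<Sum>k<p. length (f k)) + j) = f p ! j"
proof -
  have "[0..<r] = [0..<p] @ p # [Suc p..<r]"
    using assms(1) upt_add_eq_append[of 0 p "r - p"] by (simp add: upt_conv_Cons)
  then have "concat (map f [0..<r])
      = concat (map f [0..<p]) @ f p @ concat (map f [Suc p..<r])"
    by simp
  then show ?thesis
    using assms(2) by (simp add: nth_append length_concat_map_upt del: concat_map_singleton)
qed

lemma block_index_less:
  fixes a :: "nat \<Rightarrow> nat"
  assumes "p < r" "j < a p"
  shows "(\<Sum>k<p. a k) + j < (\<Sum>k<r. a k)"
proof -
  have "(\<Sum>k<Suc p. a k) \<le> (\<Sum>k<r. a k)"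
    using assms(1) by (intro sum_mono2) auto
  then show ?thesis using assms(2) by simp
qed

lemma block_index_exhaust:
  fixes a :: "nat \<Rightarrow> nat"
  assumes "l < (\<Sum>k<r. a k)"
  obtains p j where "p < r" "j < a p" "l = (\<Sum>k<p. a k) + j"
  using assms
proof (induction r arbitrary: thesis)
  case (Suc r)
  show ?case
  proof (cases "l < (\<Sum>k<r. a k)")
    case True
    then show ?thesis using Suc.IH Suc.prems(1) less_SucI by metis
  next
    case False
    then show ?thesis
      using Suc.prems(2) by (intro Suc.prems(1)[of r "l - (\<Sum>k<r. a k)"]) auto
  qed
qed simp

lemma block_index_inject:
  fixes a :: "nat \<Rightarrow> nat"
  assumes "j < a p" "j' < a p'" "(\<Sum>k<p. a k) + j = (\<Sum>k<p'. a k) + j'"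
  shows "p = p' \<and> j = j'"
proof -
  have "\<not> p < p'" using block_index_less[of p p' j a] assms by auto
  moreover have "\<not> p' < p" using block_index_less[of p' p j' a] assms by auto
  ultimately show ?thesis using assms by (metis add_left_cancel linorder_neqE_nat)
qed

subsection \<open>Columns and deficits\<close>

lemma translate_mem_level_iff:
  "x + (lefts C ! j - lefts C ! i) \<in> level C j \<longleftrightarrow> x \<in> level C i"
  by (auto simp: level_def)

lemma disjoint_levelsD:
  "\<lbrakk>disjoint_levels C; x \<in> level C i; x \<in> level C j; i < height C; j < height C\<rbrakk> \<Longrightarrow> i = j"
  unfolding disjoint_levels_def disjoint_family_on_def by blast

lemma column_map_eq_Some_iff:
  assumes "disjoint_levels C"
  shows "column_map C x = Some y \<longleftrightarrow>
    (\<exists>j. Suc j < height C \<and> x \<in> level C j \<and> y = x + (lefts C ! Suc j - lefts C ! j))"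
proof (cases "\<exists>i. Suc i < height C \<and> x \<in> level C i")
  case True
  then obtain i where i: "Suc i < height C" "x \<in> level C i" by blast
  have unique: "j = i" if "Suc j < height C" "x \<in> level C j" for j
    using disjoint_levelsD[OF assms that(2) i(2)] that(1) i(1) by simp
  then have the_level: "(THE j. j + 1 < height C \<and> x \<in> level C j) = i"
    unfolding Suc_eq_plus1[symmetric] using i unique by blast
  have "column_map C x = Some (x + (lefts C ! Suc i - lefts C ! i))"
    unfolding column_map_def the_level Let_def using i by auto
  then show ?thesis using i unique by (metis option.inject)
qed (auto simp: column_map_def)

lemma level_lmeasurable [simp]: "level C j \<in> lmeasurable"
  unfolding level_def by (intro bounded_set_imp_lmeasurable) auto

lemma level_sets_lebesgue [simp]: "level C j \<in> sets lebesgue"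
  by (simp add: fmeasurableD)

lemma level_diff_lmeasurable:
  "A \<in> sets lebesgue \<Longrightarrow> level C j - A \<in> lmeasurable"
  by (simp add: fmeasurable_Diff)

lemma measure_level: "0 < lvl_length C \<Longrightarrow> measure lebesgue (level C j) = lvl_length C"
  by (simp add: level_def)

lemma measure_Union_levels_diff:
  assumes "disjoint_levels C" "J \<subseteq> {..<height C}" "A \<in> sets lebesgue"
  shows "measure lebesgue ((\<Union>j\<in>J. level C j) - A) = (\<Sum>j\<in>J. measure lebesgue (level C j - A))"
proof -
  have "finite J" using assms(2) finite_subset by blast
  moreover have "pairwise (\<lambda>i j. disjnt (level C i - A) (level C j - A)) J"
    unfolding pairwise_def disjnt_def using assms(1,2) disjoint_levelsD by blast
  ultimately have "measure lebesgue (\<Union>j\<in>J. level C j - A)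
      = (\<Sum>j\<in>J. measure lebesgue (level C j - A))"
    using assms(3) by (intro measure_UNION' level_diff_lmeasurable)
  then show ?thesis by simp
qed

definition deficit :: "real set \<Rightarrow> column \<Rightarrow> nat \<Rightarrow> real" where
  "deficit A C j = measure lebesgue (level C j - A) / lvl_length C"

lemma deficit_nonneg: "0 \<le> deficit A C j"
proof (cases "0 < lvl_length C")
  case False
  then have "level C j = {}" by (auto simp: level_def)
  then show ?thesis by (simp add: deficit_def)
qed (simp add: deficit_def)

lemma measure_Union_levels_deficit_le:
  assumes "disjoint_levels C" "0 < lvl_length C" "J \<subseteq> {..<height C}" "A \<in> sets lebesgue"
    and "\<And>j. j \<in> J \<Longrightarrow> e \<le> deficit A C j"
  shows "e * measure lebesgue (\<Union>j\<in>J. level C j) \<le> measure lebesgue ((\<Union>j\<in>J. level C j) - A)"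
proof -
  have "e * measure lebesgue (\<Union>j\<in>J. level C j) = (\<Sum>j\<in>J. e * lvl_length C)"
    using measure_Union_levels_diff[OF assms(1,3), of "{}"] assms(2) by (simp add: measure_level)
  also have "\<dots> \<le> (\<Sum>j\<in>J. measure lebesgue (level C j - A))"
    using assms(2,5) by (intro sum_mono) (simp add: deficit_def pos_le_divide_eq)
  also have "\<dots> = measure lebesgue ((\<Union>j\<in>J. level C j) - A)"
    using measure_Union_levels_diff[OF assms(1,3,4)] by simp
  finally show ?thesis .
qed

lemma emeasure_level_overlap_pos:
  assumes "0 < lvl_length C" and A: "A \<in> sets lebesgue" and B: "B \<in> sets lebesgue"
    and small: "deficit B C i + deficit A C j < 1"
  shows "0 < emeasure lebesgue {x \<in> level C i \<inter> B. x + (lefts C ! j - lefts C ! i) \<in> A}"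
proof -
  define c where "c = lefts C ! j - lefts C ! i"
  define P where "P = level C i - B"
  define Q where "Q = (+) (- c) ` (level C j - A)"
  have P: "P \<in> lmeasurable" and Q: "Q \<in> lmeasurable"
    using level_diff_lmeasurable[OF A] level_diff_lmeasurable[OF B]
    unfolding P_def Q_def by (blast intro: measurable_translation)+
  have Q_iff: "x \<in> Q \<longleftrightarrow> x \<in> level C i \<and> x + c \<notin> A" for x
  proof -
    have "x \<in> Q \<longleftrightarrow> x + c \<in> level C j - A" by (force simp: Q_def image_iff)
    then show ?thesis by (simp add: c_def translate_mem_level_iff)
  qed
  have "measure lebesgue (P \<union> Q) \<le> measure lebesgue P + measure lebesgue Q"
    using P Q by (intro measure_Un_le) (auto simp: fmeasurableD)
  also have "\<dots> < lvl_length C"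
    using small assms(1) unfolding P_def Q_def measure_translation deficit_def
    by (simp add: add_divide_distrib[symmetric])
  finally have "0 < measure lebesgue (level C i) - measure lebesgue (P \<union> Q)"
    using assms(1) by (simp add: measure_level)
  also have "\<dots> = measure lebesgue (level C i - (P \<union> Q))"
    using P Q Q_iff by (intro measurable_measure_Diff[symmetric]) (auto simp: P_def fmeasurableD)
  also have "level C i - (P \<union> Q) = {x \<in> level C i \<inter> B. x + c \<in> A}"
    by (auto simp: P_def Q_iff)
  finally show ?thesis
    unfolding c_def measure_def by (simp add: enn2real_positive_iff)
qed

lemma level_subcolumn:
  assumes "j < height C"
  shows "level (subcolumn C r p) j =
    {lefts C ! j + real p * (lvl_length C / real r)
      ..<lefts C ! j + (real p + 1) * (lvl_length C / real r)}"
  using assms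
  by (simp add: level_def subcolumn_def height_def add_divide_distrib distrib_right add.assoc)

lemma level_eq_Union_subcolumns:
  assumes "0 < r" "j < height C"
  shows "level C j = (\<Union>p<r. level (subcolumn C r p) j)"
proof (cases "0 < lvl_length C")
  case True
  define v where "v = lvl_length C / real r"
  have v: "0 < v" "lvl_length C = real r * v" using True assms(1) by (simp_all add: v_def)
  show ?thesis
  proof (intro equalityI subsetI)
    fix x assume x: "x \<in> level C j"
    define y where "y = (x - lefts C ! j) / v"
    have y: "0 \<le> y" "y < real r" "x = lefts C ! j + y * v"
      using x v by (auto simp: y_def level_def divide_less_eq)
    define p where "p = nat \<lfloor>y\<rfloor>"
    have p: "real p \<le> y" "y < real p + 1"
      using y(1) unfolding p_def by linarith+
    then have "x \<in> level (subcolumn C r p) j"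
      using v(1) y(3) by (simp add: level_subcolumn[OF assms(2)] flip: v_def)
    moreover have "p < r" using p(1) y(2) by simp
    ultimately show "x \<in> (\<Union>p<r. level (subcolumn C r p) j)" by blast
  next
    fix x assume "x \<in> (\<Union>p<r. level (subcolumn C r p) j)"
    then obtain p where p: "p < r" "x \<in> level (subcolumn C r p) j" by blast
    have "(real p + 1) * v \<le> lvl_length C"
      using p(1) v by (simp add: mult_right_mono)
    moreover have "0 \<le> real p * v" using v(1) by simp
    ultimately show "x \<in> level C j"
      using p(2) unfolding level_subcolumn[OF assms(2)] v_def[symmetric] by (auto simp: level_def)
  qed
qed (use assms in \<open>auto simp: level_def subcolumn_def zero_less_divide_iff\<close>)

lemma subcolumn_levels_disjoint:
  assumes "j < height C" "x \<in> level (subcolumn C r p) j" "x \<in> level (subcolumn C r q) j"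
  shows "p = q"
proof -
  define v where "v = lvl_length C / real r"
  have "real p * v < (real q + 1) * v" "real q * v < (real p + 1) * v"
    "real p * v < (real p + 1) * v"
    using assms(2,3) unfolding level_subcolumn[OF assms(1)] v_def by auto
  then have "real p < real q + 1" "real q < real p + 1"
    by (auto simp: mult_less_cancel_right)
  then show ?thesis by linarith
qed

subsection \<open>One step of cutting and stacking\<close>

definition spacer_column :: "column \<Rightarrow> nat \<Rightarrow> (nat \<Rightarrow> real list) \<Rightarrow> column" where
  "spacer_column C r sp = \<lparr>lvl_length = lvl_length C / real r, lefts = concat (map sp [0..<r])\<rparr>"

definition subcolumn_offset :: "column \<Rightarrow> (nat \<Rightarrow> nat) \<Rightarrow> nat \<Rightarrow> nat" where
  "subcolumn_offset C s p = (\<Sum>k<p. height C + s k)"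

locale cutting =
  fixes r :: nat and s :: "nat \<Rightarrow> nat" and C :: column and sp :: "nat \<Rightarrow> real list" and C' :: column
  assumes r_pos: "0 < r"
    and length_spacers: "k < r \<Longrightarrow> length (sp k) = s k"
    and disjoint_spacers: "disjoint_levels (spacer_column C r sp)"
    and spacers_outside: "column_union (spacer_column C r sp) \<inter> column_union C = {}"
    and stacked: "C' = \<lparr>lvl_length = lvl_length C / real r,
      lefts = concat (map (\<lambda>k. lefts (subcolumn C r k) @ sp k) [0..<r])\<rparr>"

lemma cut_and_stack_iff_cutting:
  "0 < r \<Longrightarrow> cut_and_stack r s C C' \<longleftrightarrow> (\<exists>sp. cutting r s C sp C')"
  by (auto simp: cut_and_stack_def cutting_def spacer_column_def Let_def)

context cutting
begin

abbreviation offset :: "nat \<Rightarrow> nat" where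
  "offset \<equiv> subcolumn_offset C s"

lemma lvl_length_stacked: "lvl_length C' = lvl_length C / real r"
  by (simp add: stacked)

lemma offset_eq_length_sum:
  "p \<le> r \<Longrightarrow> offset p = (\<Sum>k<p. length (lefts (subcolumn C r k) @ sp k))"
  unfolding subcolumn_offset_def
  by (intro sum.cong) (auto simp: length_spacers subcolumn_def height_def)

lemma height_stacked: "height C' = offset r"
  unfolding offset_eq_length_sum[OF order_refl]
  by (simp only: stacked height_def column.simps length_concat_map_upt)

lemma offset_add_less: "\<lbrakk>p < r; i < height C + s p\<rbrakk> \<Longrightarrow> offset p + i < height C'"
  unfolding height_stacked subcolumn_offset_def by (rule block_index_less)

lemma offset_add_inject:
  "\<lbrakk>offset p + i = offset q + j; i < height C + s p; j < height C + s q\<rbrakk> \<Longrightarrow> p = q \<and> i = j"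
  unfolding subcolumn_offset_def by (rule block_index_inject[where a = "\<lambda>k. height C + s k"])

lemma lefts_stacked:
  assumes "p < r" "i < height C + s p"
  shows "lefts C' ! (offset p + i) = (lefts (subcolumn C r p) @ sp p) ! i"
proof -
  let ?block = "\<lambda>k. lefts (subcolumn C r k) @ sp k"
  have "i < length (?block p)"
    using assms by (simp add: length_spacers subcolumn_def height_def)
  then have "concat (map ?block [0..<r]) ! ((\<Sum>k<p. length (?block k)) + i) = ?block p ! i"
    by (rule nth_concat_map_upt[OF assms(1)])
  then show ?thesis
    using assms(1) by (simp only: stacked column.simps offset_eq_length_sum less_imp_le)
qed

lemma lefts_stacked_subcolumn:
  assumes "p < r" "j < height C"
  shows "lefts C' ! (offset p + j) = lefts C ! j + real p * (lvl_length C / real r)"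
  using assms by (simp add: lefts_stacked nth_append subcolumn_def height_def)

lemma level_stacked_subcolumn:
  assumes "p < r" "j < height C"
  shows "level C' (offset p + j) = level (subcolumn C r p) j"
  unfolding level_subcolumn[OF assms(2)] level_def[of C'] lefts_stacked_subcolumn[OF assms]
    lvl_length_stacked
  by (simp add: add_divide_distrib distrib_right add.assoc)

lemma level_eq_Union_stacked: "j < height C \<Longrightarrow> level C j = (\<Union>p<r. level C' (offset p + j))"
  using level_eq_Union_subcolumns[OF r_pos] by (simp add: level_stacked_subcolumn)

lemma level_stacked_spacer:
  assumes "p < r" "t < s p"
  shows "level C' (offset p + (height C + t)) = level (spacer_column C r sp) ((\<Sum>k<p. s k) + t)"
proof -
  have "lefts C' ! (offset p + (height C + t)) = sp p ! t"
    using lefts_stacked[OF assms(1), of "height C + t"] assms(2)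
    by (simp add: nth_append subcolumn_def height_def)
  also have "\<dots> = lefts (spacer_column C r sp) ! ((\<Sum>k<p. s k) + t)"
    using nth_concat_map_upt[OF assms(1), of t sp] assms
    by (simp add: spacer_column_def length_spacers)
  finally show ?thesis by (simp add: level_def lvl_length_stacked spacer_column_def)
qed

lemma spacer_index_less:
  "\<lbrakk>p < r; t < s p\<rbrakk> \<Longrightarrow> (\<Sum>k<p. s k) + t < height (spacer_column C r sp)"
  by (simp add: height_def spacer_column_def length_concat_map_upt length_spacers block_index_less)

lemma level_stacked_cases:
  assumes "i < height C'" "x \<in> level C' i"
  obtains
    (subcolumn) p j where "p < r" "j < height C" "i = offset p + j"
      "x \<in> level (subcolumn C r p) j" "x \<in> level C j"
  | (spacer) p t where "p < r" "t < s p" "i = offset p + (height C + t)"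
      "x \<in> level (spacer_column C r sp) ((\<Sum>k<p. s k) + t)" "x \<notin> column_union C"
proof -
  obtain p l where p: "p < r" "l < height C + s p" "i = offset p + l"
    using assms(1) unfolding height_stacked subcolumn_offset_def by (rule block_index_exhaust)
  show thesis
  proof (cases "l < height C")
    case True
    then show thesis
      using subcolumn[OF p(1)] p assms(2) level_stacked_subcolumn level_eq_Union_stacked by auto
  next
    case False
    then obtain t where t: "l = height C + t" "t < s p"
      using p(2) by (metis add_less_cancel_left le_add_diff_inverse not_less)
    have "x \<in> level (spacer_column C r sp) ((\<Sum>k<p. s k) + t)"
      using assms(2) level_stacked_spacer[OF p(1) t(2)] p(3) t(1) by simp
    moreover from this have "x \<notin> column_union C"
      using spacers_outside spacer_index_less[OF p(1) t(2)] by (auto simp: column_union_def)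
    ultimately show thesis using spacer p t by simp
  qed
qed

lemma disjoint_levels_stacked:
  assumes "disjoint_levels C"
  shows "disjoint_levels C'"
proof -
  have "i = i'" if i: "i < height C'" "x \<in> level C' i" and i': "i' < height C'" "x \<in> level C' i'"
    for i i' x
    using i
  proof (cases rule: level_stacked_cases)
    case (subcolumn p j)
    from i' obtain p' j' where "p' < r" "j' < height C" "i' = offset p' + j'"
      "x \<in> level (subcolumn C r p') j'" "x \<in> level C j'"
      using subcolumn by (cases rule: level_stacked_cases) (auto simp: column_union_def)
    moreover from this have "j = j'"
      using disjoint_levelsD[OF assms] subcolumn by blast
    ultimately show ?thesis
      using subcolumn subcolumn_levels_disjoint by blast
  next
    case (spacer p t)
    from i' obtain p' t' where "p' < r" "t' < s p'" "i' = offset p' + (height C + t')"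
      "x \<in> level (spacer_column C r sp) ((\<Sum>k<p'. s k) + t')"
      using spacer by (cases rule: level_stacked_cases) (auto simp: column_union_def)
    moreover from this have "(\<Sum>k<p. s k) + t = (\<Sum>k<p'. s k) + t'"
      using disjoint_levelsD[OF disjoint_spacers] spacer spacer_index_less by blast
    ultimately show ?thesis
      using spacer block_index_inject[of t s p t' p'] by simp
  qed
  then show ?thesis by (auto simp: disjoint_levels_def disjoint_family_on_def)
qed

lemma column_union_subset_stacked: "column_union C \<subseteq> column_union C'"
  using offset_add_less by (fastforce simp: column_union_def level_eq_Union_stacked)

lemma column_map_stacked:
  assumes "disjoint_levels C" "column_map C x = Some y"
  shows "column_map C' x = Some y"
proof -
  obtain j where j: "Suc j < height C" "x \<in> level C j" "y = x + (lefts C ! Suc j - lefts C ! j)"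
    using assms by (auto simp: column_map_eq_Some_iff)
  then obtain p where p: "p < r" "x \<in> level C' (offset p + j)"
    by (auto simp: level_eq_Union_stacked)
  have "y = x + (lefts C' ! Suc (offset p + j) - lefts C' ! (offset p + j))"
    using j p(1) lefts_stacked_subcolumn[of p "Suc j"] by (simp add: lefts_stacked_subcolumn)
  moreover have "Suc (offset p + j) < height C'"
    using offset_add_less[OF p(1), of "Suc j"] j(1) by simp
  ultimately show ?thesis
    using p(2) disjoint_levels_stacked[OF assms(1)] by (auto simp: column_map_eq_Some_iff)
qed

lemma below_top_or_right_aligned:
  assumes "x \<in> level C j" "j < height C"
  obtains (below_top) i where "x \<in> level C' i" "Suc i < height C'"
  | (right_aligned) i where "x \<in> level C' i" "i < height C'"
      "lefts C' ! i + lvl_length C' = lefts C ! j + lvl_length C"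
proof -
  obtain p where p: "p < r" "x \<in> level C' (offset p + j)"
    using assms by (auto simp: level_eq_Union_stacked)
  show thesis
  proof (cases "Suc p < r")
    case True
    have "Suc (offset p + j) \<le> offset (Suc p) + 0"
      using assms(2) by (simp add: subcolumn_offset_def)
    also have "\<dots> < height C'" using True assms(2) by (intro offset_add_less) auto
    finally show thesis using below_top p(2) by blast
  next
    case False
    then have "real p = real r - 1" using p(1) by linarith
    then have "lefts C' ! (offset p + j) + lvl_length C' = lefts C ! j + lvl_length C"
      using r_pos
      by (simp add: lefts_stacked_subcolumn[OF p(1) assms(2)] lvl_length_stacked
          left_diff_distrib diff_divide_distrib)
    then show thesis using right_aligned p offset_add_less assms(2) by simp
  qed
qed

lemma sum_deficit_stacked:
  assumes "disjoint_levels C" "A \<in> sets lebesgue" "j < height C"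
  shows "(\<Sum>p<r. deficit A C' (offset p + j)) = real r * deficit A C j"
proof -
  have inj: "inj_on (\<lambda>p. offset p + j) {..<r}"
    using assms(3) by (auto intro!: inj_onI dest: offset_add_inject)
  have "(\<lambda>p. offset p + j) ` {..<r} \<subseteq> {..<height C'}"
    using assms(3) offset_add_less by auto
  from measure_Union_levels_diff[OF disjoint_levels_stacked[OF assms(1)] this assms(2)]
  have "measure lebesgue (level C j - A)
      = (\<Sum>i\<in>(\<lambda>p. offset p + j) ` {..<r}. measure lebesgue (level C' i - A))"
    by (simp add: level_eq_Union_stacked[OF assms(3)])
  also have "\<dots> = (\<Sum>p<r. measure lebesgue (level C' (offset p + j) - A))"
    by (simp add: sum.reindex[OF inj])
  finally show ?thesis
    by (simp add: deficit_def lvl_length_stacked flip: sum_divide_distrib sum_distrib_right)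
qed

lemma small_deficits_stacked:
  assumes "disjoint_levels C" "A \<in> sets lebesgue" "B \<in> sets lebesgue" "i < height C" "j < height C"
    and "deficit A C i + deficit B C j < c"
  obtains p where "p < r" "deficit A C' (offset p + i) + deficit B C' (offset p + j) < c"
proof (rule ccontr)
  assume "\<not> thesis"
  then have "(\<Sum>p<r. c) \<le> (\<Sum>p<r. deficit A C' (offset p + i) + deficit B C' (offset p + j))"
    using that by (intro sum_mono) (meson lessThan_iff not_less)
  then have "real r * c \<le> real r * (deficit A C i + deficit B C j)"
    using assms by (simp add: sum.distrib sum_deficit_stacked distrib_left)
  then show False using assms(6) r_pos by simp
qed

end

subsection \<open>Rank-one transformations\<close>

context rank_one
begin

abbreviation h :: "nat \<Rightarrow> nat" where "h n \<equiv> height (C n)"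
abbreviation w :: "nat \<Rightarrow> real" where "w n \<equiv> lvl_length (C n)"
abbreviation T :: "real \<Rightarrow> real" where "T \<equiv> rank_one_map C"
abbreviation X :: "real set" where "X \<equiv> rank_one_space C"
abbreviation M :: "real measure" where "M \<equiv> rank_one_measure C"

definition spacers :: "nat \<Rightarrow> nat \<Rightarrow> real list" where
  "spacers n = (SOME sp. cutting (r n) (s n) (C n) sp (C (Suc n)))"

end

sublocale rank_one \<subseteq> stage: cutting "r n" "s n" "C n" "spacers n" "C (Suc n)" for n
proof -
  have "0 < r n" using cuts[of n] by simp
  then have "\<exists>sp. cutting (r n) (s n) (C n) sp (C (Suc n))"
    using step[of n] by (simp add: cut_and_stack_iff_cutting)
  then show "cutting (r n) (s n) (C n) (spacers n) (C (Suc n))"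
    unfolding spacers_def by (rule someI_ex)
qed

context rank_one
begin

lemma lvl_length_pos: "0 < w n"
  by (induction n) (simp_all add: base unit_column_def stage.lvl_length_stacked stage.r_pos)

lemma lvl_length_le_power: "w n \<le> (1 / 2) ^ n"
proof (induction n)
  case 0
  then show ?case by (simp add: base unit_column_def)
next
  case (Suc n)
  have "w (Suc n) \<le> w n / 2"
    unfolding stage.lvl_length_stacked
    using cuts[of n] lvl_length_pos[of n] by (intro divide_left_mono) auto
  then show ?case using Suc by simp
qed

lemma lvl_length_tendsto_0: "w \<longlonglongrightarrow> 0"
proof (rule tendsto_sandwich[OF _ _ tendsto_const])
  show "\<forall>\<^sub>F n in sequentially. 0 \<le> w n"
    using lvl_length_pos by (simp add: less_imp_le)
  show "\<forall>\<^sub>F n in sequentially. w n \<le> (1 / 2) ^ n"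
    using lvl_length_le_power by simp
  show "(\<lambda>n. (1 / 2 :: real) ^ n) \<longlonglongrightarrow> 0"
    by (rule LIMSEQ_power_zero) simp
qed

lemma disjoint_levels_column: "disjoint_levels (C n)"
proof (induction n)
  case 0
  then show ?case
    by (simp add: base unit_column_def disjoint_levels_def disjoint_family_on_def height_def)
qed (rule stage.disjoint_levels_stacked)

lemma column_union_mono: "n \<le> m \<Longrightarrow> column_union (C n) \<subseteq> column_union (C m)"
  by (rule lift_Suc_mono_le[of "\<lambda>n. column_union (C n)"]) (rule stage.column_union_subset_stacked)

lemma level_subset_space: "j < h n \<Longrightarrow> level (C n) j \<subseteq> X"
  by (auto simp: rank_one_space_def column_union_def)

lemma column_map_mono:
  assumes "n \<le> m" "column_map (C n) x = Some y"
  shows "column_map (C m) x = Some y"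
  using assms(1)
proof (induction m rule: dec_induct)
  case (step m)
  then show ?case using stage.column_map_stacked[OF disjoint_levels_column] by blast
qed (rule assms(2))

lemma rank_one_map_eq:
  assumes "x \<in> level (C n) j" "Suc j < h n"
  shows "T x = x + (lefts (C n) ! Suc j - lefts (C n) ! j)" (is "_ = ?y")
proof -
  have "column_map (C n) x = Some ?y"
    using assms by (auto simp: column_map_eq_Some_iff[OF disjoint_levels_column])
  then have "\<forall>m\<ge>n. the (column_map (C m) x) = ?y" using column_map_mono by simp
  then show ?thesis
    unfolding rank_one_map_def
    by (intro limI tendsto_eventually) (auto simp: eventually_sequentially)
qed

lemma rank_one_map_funpow_eq:
  assumes "x \<in> level (C n) j" "j + t < h n"
  shows "(T ^^ t) x = x + (lefts (C n) ! (j + t) - lefts (C n) ! j)"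
  using assms(2)
proof (induction t)
  case (Suc t)
  then have "(T ^^ Suc t) x = T (x + (lefts (C n) ! (j + t) - lefts (C n) ! j))" by simp
  also have "\<dots> = x + (lefts (C n) ! (j + t) - lefts (C n) ! j)
      + (lefts (C n) ! Suc (j + t) - lefts (C n) ! (j + t))"
    using Suc.prems assms(1) by (intro rank_one_map_eq) (simp_all add: translate_mem_level_iff)
  finally show ?case by simp
qed simp

text \<open>
  A point that is in the top level of all late columns would be in levels with one common right
  endpoint and with lengths tending to zero, but levels do not contain their right endpoints.
\<close>
lemma ex_level_below_top:
  assumes "x \<in> X"
  shows "\<exists>n j. x \<in> level (C n) j \<and> Suc j < h n"
proof (rule ccontr)
  assume always_top: "\<not> ?thesis"
  obtain n j where j: "j < h n" "x \<in> level (C n) j"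
    using assms by (auto simp: rank_one_space_def column_union_def)
  define e where "e = lefts (C n) ! j + w n"
  have aligned: "\<exists>i<h m. x \<in> level (C m) i \<and> lefts (C m) ! i + w m = e" if "n \<le> m" for m
    using that
  proof (induction m rule: dec_induct)
    case (step m)
    then obtain i where i: "i < h m" "x \<in> level (C m) i" "lefts (C m) ! i + w m = e" by blast
    show ?case
      using i(2,1) by (rule stage.below_top_or_right_aligned) (use always_top i(3) in auto)
  qed (use j e_def in auto)
  have "e - x \<le> w m" if "n \<le> m" for m
    using aligned[OF that] by (auto simp: level_def)
  then have "e - x \<le> 0" using lvl_length_tendsto_0 by (intro LIMSEQ_le_const) auto
  moreover have "x < e" using j(2) by (simp add: e_def level_def)
  ultimately show False by simp
qed

lemma space_rank_one_measure: "space M = X"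
  by (simp add: rank_one_measure_def space_restrict_space)

lemma rank_one_space_sets: "X \<in> sets lebesgue"
  unfolding rank_one_space_def column_union_def
  by (intro sets.countable_UN sets.finite_UN) auto

lemma sets_rank_one_measure: "A \<in> sets M \<longleftrightarrow> A \<subseteq> X \<and> A \<in> sets lebesgue"
  unfolding rank_one_measure_def using rank_one_space_sets by (subst sets_restrict_space_iff) auto

lemma emeasure_rank_one_measure: "A \<subseteq> X \<Longrightarrow> emeasure M A = emeasure lebesgue A"
  unfolding rank_one_measure_def using rank_one_space_sets by (subst emeasure_restrict_space) auto

lemma rank_one_map_measurable: "T \<in> M \<rightarrow>\<^sub>M M"
proof -
  let ?P = "{level (C n) j | n j. Suc j < h n}"
  have "T \<in> M \<rightarrow>\<^sub>M lebesgue"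
  proof (rule measurable_piecewise_restrict)
    show "countable ?P"
      by (rule countable_subset[of _ "(\<lambda>(n, j). level (C n) j) ` UNIV"]) auto
    show "space M \<subseteq> \<Union>?P"
      using ex_level_below_top by (fastforce simp: space_rank_one_measure)
    fix \<Omega> assume "\<Omega> \<in> ?P"
    then obtain n j where j: "\<Omega> = level (C n) j" "Suc j < h n" by blast
    show "\<Omega> \<inter> space M \<in> sets M"
      using rank_one_space_sets
      by (simp add: j(1) space_rank_one_measure sets_rank_one_measure sets.Int)
    let ?c = "lefts (C n) ! Suc j - lefts (C n) ! j"
    have "(\<lambda>x. x + ?c) \<in> restrict_space M \<Omega> \<rightarrow>\<^sub>M lebesgue"
      using lebesgue_affine_measurable[of "\<lambda>_. 1" ?c]
      by (auto simp: rank_one_measure_def add.commute intro!: measurable_restrict_space1)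
    then show "T \<in> restrict_space M \<Omega> \<rightarrow>\<^sub>M lebesgue"
      by (rule measurable_cong[THEN iffD2, rotated])
        (use j rank_one_map_eq in \<open>auto simp: space_restrict_space\<close>)
  qed
  moreover have "T x \<in> X" if x: "x \<in> X" for x
  proof -
    obtain n j where j: "x \<in> level (C n) j" "Suc j < h n" using ex_level_below_top[OF x] by blast
    then have "T x \<in> level (C n) (Suc j)" by (simp add: rank_one_map_eq translate_mem_level_iff)
    then show ?thesis using level_subset_space[OF j(2)] by blast
  qed
  ultimately have "T \<in> M \<rightarrow>\<^sub>M lebesgue_on X"
    by (intro measurable_restrict_space2) (auto simp: space_rank_one_measure)
  then show ?thesis by (simp only: rank_one_measure_def)
qed

lemma rank_one_map_funpow_measurable: "T ^^ t \<in> M \<rightarrow>\<^sub>M M"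
proof (induction t)
  case (Suc t)
  then show ?case using measurable_comp[OF Suc rank_one_map_measurable] by (simp add: comp_def)
qed (simp add: id_def)

subsection \<open>Levels with small deficits\<close>

lemma emeasure_visit_pos:
  assumes A: "A \<in> sets M" and B: "B \<in> sets M" and "j + t < h n"
    and "deficit B (C n) j + deficit A (C n) (j + t) < 1"
  shows "0 < emeasure M (B \<inter> ((T ^^ t) -` A \<inter> space M))"
proof -
  let ?S = "{x \<in> level (C n) j \<inter> B. x + (lefts (C n) ! (j + t) - lefts (C n) ! j) \<in> A}"
  let ?R = "B \<inter> ((T ^^ t) -` A \<inter> space M)"
  have "?R \<in> sets M"
    using measurable_sets[OF rank_one_map_funpow_measurable A] B by auto
  then have R: "?R \<in> sets lebesgue" "?R \<subseteq> X" by (auto simp only: sets_rank_one_measure)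
  have "?S \<subseteq> ?R"
    using B rank_one_map_funpow_eq[OF _ assms(3)]
    by (auto simp: space_rank_one_measure sets_rank_one_measure)
  have "0 < emeasure lebesgue ?S"
    using A B assms(4) lvl_length_pos
    by (intro emeasure_level_overlap_pos) (auto simp: sets_rank_one_measure)
  also have "\<dots> \<le> emeasure lebesgue ?R"
    using \<open>?S \<subseteq> ?R\<close> R(1) by (rule emeasure_mono)
  finally show ?thesis using emeasure_rank_one_measure[OF R(2)] by simp
qed

lemma small_deficits_descend:
  assumes "n \<le> m" and AB: "A \<in> sets lebesgue" "B \<in> sets lebesgue"
    and ij: "i < h n" "j < h n" "deficit A (C n) i + deficit B (C n) j < c"
  obtains q where "q + i < h m" "q + j < h m"
    "deficit A (C m) (q + i) + deficit B (C m) (q + j) < c"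
  using assms(1)
proof (induction m arbitrary: thesis rule: dec_induct)
  case base
  then show ?case using ij by (metis add_0)
next
  case (step m)
  obtain q where q: "q + i < h m" "q + j < h m"
    "deficit A (C m) (q + i) + deficit B (C m) (q + j) < c"
    by (rule step.IH)
  obtain p where "p < r m"
    "deficit A (C (Suc m)) (stage.offset m p + (q + i))
      + deficit B (C (Suc m)) (stage.offset m p + (q + j)) < c"
    using disjoint_levels_column AB q by (rule stage.small_deficits_stacked)
  then show ?case
    using q(1,2) stage.offset_add_less
    by (intro step.prems[of "stage.offset m p + q"]) (auto simp: add.assoc)
qed

definition inner_levels :: "real set \<Rightarrow> nat \<Rightarrow> nat set" where
  "inner_levels U n = {j. j < h n \<and> level (C n) j \<subseteq> U}"

abbreviation inner_union :: "real set \<Rightarrow> nat \<Rightarrow> real set" where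
  "inner_union U n \<equiv> \<Union>j\<in>inner_levels U n. level (C n) j"

lemma incseq_inner_union: "incseq (inner_union U)"
proof (intro incseq_SucI subsetI)
  fix n x assume "x \<in> inner_union U n"
  then obtain j where j: "j < h n" "level (C n) j \<subseteq> U" "x \<in> level (C n) j"
    by (auto simp: inner_levels_def)
  then obtain p where p: "p < r n" "x \<in> level (C (Suc n)) (stage.offset n p + j)"
    by (auto simp: stage.level_eq_Union_stacked)
  moreover have "stage.offset n p + j \<in> inner_levels U (Suc n)"
    using j p(1) stage.offset_add_less[of p n j] stage.level_eq_Union_stacked[OF j(1)]
    by (auto simp: inner_levels_def)
  ultimately show "x \<in> inner_union U (Suc n)" by blast
qed

lemma Union_inner_union:
  assumes "open U"
  shows "(\<Union>n. inner_union U n) = U \<inter> X"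
proof (intro equalityI subsetI)
  fix x assume "x \<in> (\<Union>n. inner_union U n)"
  then show "x \<in> U \<inter> X" using level_subset_space by (fastforce simp: inner_levels_def)
next
  fix x assume x: "x \<in> U \<inter> X"
  then obtain n0 where n0: "x \<in> column_union (C n0)" by (auto simp: rank_one_space_def)
  obtain d where d: "0 < d" "ball x d \<subseteq> U" using assms x by (meson IntD1 openE)
  have "\<forall>\<^sub>F n in sequentially. w n < d" using lvl_length_tendsto_0 d(1) by (rule order_tendstoD)
  then obtain n where n: "n0 \<le> n" "w n < d"
    using eventually_happens[OF eventually_conj[OF eventually_ge_at_top]] by auto
  obtain j where j: "j < h n" "x \<in> level (C n) j"
    using n0 column_union_mono[OF n(1)] by (auto simp: column_union_def)
  have "level (C n) j \<subseteq> ball x d"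
    using j(2) n(2) by (auto simp: level_def dist_real_def)
  then show "x \<in> (\<Union>n. inner_union U n)" using j d(2) by (auto simp: inner_levels_def)
qed

lemma inner_union_lmeasurable: "inner_union U n \<in> lmeasurable"
  by (intro fmeasurable.finite_UN) (auto simp: inner_levels_def)

lemma emeasure_inner_union_tendsto:
  assumes "open U"
  shows "(\<lambda>n. emeasure lebesgue (inner_union U n)) \<longlonglongrightarrow> emeasure lebesgue (U \<inter> X)"
proof -
  have "range (inner_union U) \<subseteq> sets lebesgue"
    by (intro image_subsetI fmeasurableD inner_union_lmeasurable)
  from Lim_emeasure_incseq[OF this incseq_inner_union] show ?thesis
    by (simp only: Union_inner_union[OF assms])
qed

lemma inner_level_small_deficit:
  assumes "A \<in> sets lebesgue" "U - A \<in> lmeasurable"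
    and "measure lebesgue (U - A) < e * measure lebesgue (inner_union U n)"
  shows "\<exists>j<h n. deficit A (C n) j < e"
proof (rule ccontr)
  assume none: "\<not> ?thesis"
  have "e * measure lebesgue (inner_union U n) \<le> measure lebesgue (inner_union U n - A)"
  proof (rule measure_Union_levels_deficit_le)
    show "e \<le> deficit A (C n) j" if "j \<in> inner_levels U n" for j
      using none that by (auto simp: inner_levels_def)
  qed (use assms(1) lvl_length_pos disjoint_levels_column in \<open>auto simp: inner_levels_def\<close>)
  also have "\<dots> \<le> measure lebesgue (U - A)"
    using assms(1,2) inner_union_lmeasurable
    by (intro measure_mono_fmeasurable) (auto simp: inner_levels_def fmeasurableD)
  finally show False using assms(3) by simp
qed

text \<open>
  If an open superset \<open>U\<close> of \<open>A\<close> exceeds \<open>A\<close> by little, then \<open>A\<close> cannot miss a fixed proportion of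
  every level contained in \<open>U\<close>, because these levels exhaust \<open>U \<inter> X\<close>.
\<close>
lemma eventually_small_deficit:
  assumes A: "A \<in> sets M" "0 < emeasure M A" and "0 < e"
  shows "\<forall>\<^sub>F n in sequentially. \<exists>j<h n. deficit A (C n) j < e"
proof -
  have "A \<subseteq> X" and A_sets: "A \<in> sets lebesgue"
    using A(1) by (auto simp: sets_rank_one_measure)
  obtain c where c: "0 < c" "c < emeasure lebesgue A"
    using A(2) dense[of 0 "emeasure lebesgue A"] emeasure_rank_one_measure[OF \<open>A \<subseteq> X\<close>] by auto
  define d where "d = enn2real c"
  have "c < top" using c(2) top_greatest by (rule order.strict_trans2)
  then have d: "0 < d" "ennreal d < emeasure lebesgue A"
    using c by (simp_all add: d_def enn2real_positive_iff)
  have "0 < e * d" using \<open>0 < e\<close> d(1) by simp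
  then obtain U where "open U" "A \<subseteq> U" and U: "U - A \<in> lmeasurable"
    "emeasure lebesgue (U - A) < ennreal (e * d)"
    using sets_lebesgue_outer_open[OF A_sets] by blast
  have "emeasure lebesgue A \<le> emeasure lebesgue (U \<inter> X)"
    using \<open>open U\<close> \<open>A \<subseteq> U\<close> \<open>A \<subseteq> X\<close> rank_one_space_sets by (intro emeasure_mono sets.Int) auto
  with d(2) have "ennreal d < emeasure lebesgue (U \<inter> X)" by (rule order.strict_trans2)
  with emeasure_inner_union_tendsto[OF \<open>open U\<close>]
  have "\<forall>\<^sub>F n in sequentially. ennreal d < emeasure lebesgue (inner_union U n)"
    by (rule order_tendstoD)
  then show ?thesis
  proof eventually_elim
    case (elim n)
    have "measure lebesgue (U - A) < e * d"
      using U(2) by (simp only: emeasure_eq_measure2[OF U(1)] ennreal_less_iff measure_nonneg)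
    also have "d < measure lebesgue (inner_union U n)"
      using elim d(1)
      by (simp add: emeasure_eq_measure2[OF inner_union_lmeasurable] ennreal_less_iff)
    then have "e * d < e * measure lebesgue (inner_union U n)" using \<open>0 < e\<close> by simp
    finally show ?case by (rule inner_level_small_deficit[OF A_sets U(1)])
  qed
qed

lemma small_deficits_in_late_columns:
  assumes A: "A \<in> sets M" "0 < emeasure M A" and B: "B \<in> sets M" "0 < emeasure M B" and "0 < e"
  obtains N :: nat and d :: real where "\<forall>n\<ge>N. \<exists>i<h n. \<exists>j<h n.
    \<bar>real i - real j\<bar> = d \<and> deficit A (C n) i + deficit B (C n) j < e"
proof -
  have "\<forall>\<^sub>F n in sequentially.
      (\<exists>i<h n. deficit A (C n) i < e / 2) \<and> (\<exists>j<h n. deficit B (C n) j < e / 2)"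
    using A B \<open>0 < e\<close> by (intro eventually_conj eventually_small_deficit) auto
  then obtain N i j where ij: "i < h N" "j < h N"
    and "deficit A (C N) i < e / 2" "deficit B (C N) j < e / 2"
    using eventually_happens'[OF sequentially_bot] by blast
  then have small: "deficit A (C N) i + deficit B (C N) j < e" by simp
  have sets: "A \<in> sets lebesgue" "B \<in> sets lebesgue"
    using A B by (auto simp: sets_rank_one_measure)
  have "\<exists>i'<h n. \<exists>j'<h n. \<bar>real i' - real j'\<bar> = \<bar>real i - real j\<bar> \<and>
      deficit A (C n) i' + deficit B (C n) j' < e" if "N \<le> n" for n
  proof -
    obtain q where "q + i < h n" "q + j < h n"
      "deficit A (C n) (q + i) + deficit B (C n) (q + j) < e"
      by (rule small_deficits_descend[OF \<open>N \<le> n\<close> sets ij small])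
    then show ?thesis by (intro exI[of _ "q + i"] exI[of _ "q + j"] conjI) auto
  qed
  then show thesis using that by blast
qed

end

subsection \<open>Staircases\<close>

definition staircase_height :: "nat \<Rightarrow> nat \<Rightarrow> nat \<Rightarrow> nat \<Rightarrow> nat" where
  "staircase_height h a k t = a + t * h + (\<Sum>q=1..t. (k + q))"

lemma staircase_height_Suc:
  "staircase_height h a k (Suc t) = staircase_height h a k t + (h + k + Suc t)"
  by (simp add: staircase_height_def)

lemma inj_staircase_height: "inj (staircase_height h a k)"
  by (intro strict_mono_imp_inj_on) (simp add: strict_mono_Suc_iff staircase_height_Suc)

lemma staircase_height_mem_staircase_set: "t < m \<Longrightarrow> staircase_height h a k t \<in> staircase_set h a k m"
  by (auto simp: staircase_set_def staircase_height_def)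

lemma height_set_eq_offsets:
  assumes "0 < r n"
  shows "height_set r s C n = subcolumn_offset (C n) (s n) ` {..<r n}"
proof -
  have "{..<r n} = insert 0 (Suc ` {..<r n - 1})"
    using assms lessThan_Suc_eq_insert_0[of "r n - 1"] by simp
  moreover have "(\<Sum>k=0..l. height (C n) + s n k) = subcolumn_offset (C n) (s n) (Suc l)" for l
    by (simp only: subcolumn_offset_def atLeast0AtMost lessThan_Suc_atMost)
  moreover have "subcolumn_offset (C n) (s n) 0 = 0" by (simp add: subcolumn_offset_def)
  ultimately show ?thesis unfolding height_set_def by auto
qed

lemma sum_shift_le:
  fixes F :: "nat \<Rightarrow> real"
  assumes "\<And>t. 0 \<le> F t" "y + l \<le> m"
  shows "(\<Sum>x<l. F (y + x)) \<le> (\<Sum>t<m. F t)"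
proof -
  have "(\<Sum>x<l. F (y + x)) = sum F ((+) y ` {..<l})" by (simp add: sum.reindex)
  also have "\<dots> \<le> (\<Sum>t<m. F t)" using assms by (intro sum_mono2) auto
  finally show ?thesis .
qed

lemma small_shifted_pairs_exist:
  fixes F G :: "nat \<Rightarrow> real"
  assumes nonneg: "\<And>t. 0 \<le> F t" "\<And>t. 0 \<le> G t"
    and small: "3 * (\<Sum>t<m. F t + G t) + real (u + v + 1) < real m"
  shows "\<exists>x. u + x + 1 < m \<and> v + x + 1 < m \<and>
    F (u + x) + F (u + x + 1) < 1 \<and> G (v + x) + F (v + x + 1) < 1"
proof (rule ccontr)
  assume none: "\<not> ?thesis"
  have "0 \<le> (\<Sum>t<m. F t + G t)" using nonneg by (simp add: sum_nonneg)
  then have "u + v + 1 \<le> m" using small by linarith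
  then obtain l where l: "m = u + v + 1 + l" using le_Suc_ex by blast
  have "1 \<le> F (u + x) + F (u + 1 + x) + (G (v + x) + F (v + 1 + x))" if "x < l" for x
  proof -
    have "u + x + 1 < m" "v + x + 1 < m" using that l by auto
    then have "1 \<le> F (u + x) + F (u + x + 1) \<or> 1 \<le> G (v + x) + F (v + x + 1)"
      using none by (meson not_less)
    then show ?thesis
      using nonneg(1)[of "u + x"] nonneg(1)[of "u + 1 + x"]
        nonneg(2)[of "v + x"] nonneg(1)[of "v + 1 + x"]
      by auto
  qed
  then have "(\<Sum>x<l. 1) \<le> (\<Sum>x<l. F (u + x) + F (u + 1 + x) + (G (v + x) + F (v + 1 + x)))"
    by (intro sum_mono) auto
  also have "\<dots> \<le> (\<Sum>t<m. F t) + (\<Sum>t<m. F t) + ((\<Sum>t<m. G t) + (\<Sum>t<m. F t))"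
    unfolding sum.distrib using l by (intro add_mono sum_shift_le nonneg) auto
  also have "\<dots> \<le> 3 * (\<Sum>t<m. F t + G t)"
    using sum_nonneg[of "{..<m}" G] nonneg(2) by (simp add: sum.distrib)
  finally show False using small l by simp
qed

context rank_one
begin

lemma staircase_subcolumns:
  assumes "staircase_set (h n) a k m \<subseteq> height_set r s C n"
  obtains c where "inj_on c {..<m}"
    "\<forall>t<m. c t < r n \<and> staircase_height (h n) a k t = stage.offset n (c t)"
proof -
  have "\<exists>p<r n. staircase_height (h n) a k t = stage.offset n p" if "t < m" for t
  proof -
    have "staircase_height (h n) a k t \<in> height_set r s C n"
      using assms staircase_height_mem_staircase_set[OF that] by (rule subsetD)
    then show ?thesis by (auto simp: height_set_eq_offsets stage.r_pos)
  qed
  then obtain c where c: "\<forall>t<m. c t < r n \<and> staircase_height (h n) a k t = stage.offset n (c t)"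
    by metis
  have "inj_on c {..<m}"
  proof (rule inj_onI)
    fix t t' assume "t \<in> {..<m}" "t' \<in> {..<m}" "c t = c t'"
    then have "staircase_height (h n) a k t = staircase_height (h n) a k t'" using c by simp
    then show "t = t'" by (rule injD[OF inj_staircase_height])
  qed
  then show thesis using that c by blast
qed

lemma staircase_copy_less:
  assumes "staircase_set (h n) a k m \<subseteq> height_set r s C n" "t < m" "i < h n"
  shows "staircase_height (h n) a k t + i < h (Suc n)"
proof -
  obtain c where "\<forall>t<m. c t < r n \<and> staircase_height (h n) a k t = stage.offset n (c t)"
    using staircase_subcolumns[OF assms(1)] by blast
  then show ?thesis using stage.offset_add_less[of "c t" n i] assms(2,3) by simp
qed

lemma sum_staircase_deficits_le:
  assumes "staircase_set (h n) a k m \<subseteq> height_set r s C n" "A \<in> sets lebesgue" "i < h n"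
  shows "(\<Sum>t<m. deficit A (C (Suc n)) (staircase_height (h n) a k t + i))
    \<le> real (r n) * deficit A (C n) i"
proof -
  obtain c where c: "inj_on c {..<m}"
    "\<forall>t<m. c t < r n \<and> staircase_height (h n) a k t = stage.offset n (c t)"
    using staircase_subcolumns[OF assms(1)] by blast
  have "(\<Sum>t<m. deficit A (C (Suc n)) (staircase_height (h n) a k t + i))
      = (\<Sum>p\<in>c ` {..<m}. deficit A (C (Suc n)) (stage.offset n p + i))"
    using c by (simp add: sum.reindex)
  also have "\<dots> \<le> (\<Sum>p<r n. deficit A (C (Suc n)) (stage.offset n p + i))"
    using c(2) by (intro sum_mono2 deficit_nonneg) auto
  also have "\<dots> = real (r n) * deficit A (C n) i"
    using disjoint_levels_column assms(2,3) by (rule stage.sum_deficit_stacked)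
  finally show ?thesis .
qed

lemma staircase_common_visit:
  assumes AB: "A \<in> sets M" "B \<in> sets M" and ij: "i < h n" "j < h n"
    and stair: "staircase_set (h n) a k m \<subseteq> height_set r s C n"
    and long: "3 * real (r n) * (deficit A (C n) i + deficit B (C n) j)
      + \<bar>real i - real j\<bar> + 1 < real m"
  shows "\<exists>t>0. 0 < emeasure M (A \<inter> ((T ^^ t) -` A \<inter> space M)) \<and>
    0 < emeasure M (B \<inter> ((T ^^ t) -` A \<inter> space M))"
proof -
  let ?\<sigma> = "staircase_height (h n) a k"
  let ?F = "\<lambda>t. deficit A (C (Suc n)) (?\<sigma> t + i)" and ?G = "\<lambda>t. deficit B (C (Suc n)) (?\<sigma> t + j)"
  define u v where "u = i - j" and "v = j - i"
  have "(\<Sum>t<m. ?F t + ?G t) \<le> real (r n) * (deficit A (C n) i + deficit B (C n) j)"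
    using AB ij stair unfolding sum.distrib distrib_left
    by (intro add_mono sum_staircase_deficits_le) (auto simp: sets_rank_one_measure)
  then have "3 * (\<Sum>t<m. ?F t + ?G t) + real (u + v + 1) < real m"
    using long by (auto simp: u_def v_def)
  then obtain x where x: "u + x + 1 < m" "v + x + 1 < m"
    "?F (u + x) + ?F (u + x + 1) < 1" "?G (v + x) + ?F (v + x + 1) < 1"
    using small_shifted_pairs_exist[of ?F ?G] deficit_nonneg by blast
  define t where "t = h n + k + Suc (u + x)"
  have up: "?\<sigma> (u + x + 1) + i = (?\<sigma> (u + x) + i) + t"
    by (simp add: t_def staircase_height_Suc)
  have across: "?\<sigma> (v + x + 1) + i = (?\<sigma> (v + x) + j) + t"
    by (simp add: t_def staircase_height_Suc u_def v_def)
  have "0 < emeasure M (A \<inter> ((T ^^ t) -` A \<inter> space M))"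
    using staircase_copy_less[OF stair x(1) ij(1)] x(3)
    unfolding up by (rule emeasure_visit_pos[OF AB(1) AB(1)])
  moreover have "0 < emeasure M (B \<inter> ((T ^^ t) -` A \<inter> space M))"
    using staircase_copy_less[OF stair x(2) ij(1)] x(4)
    unfolding across by (rule emeasure_visit_pos[OF AB])
  ultimately show ?thesis by (intro exI[of _ t]) (simp add: t_def)
qed

end

lemma ex_ge_if_not_bdd_above:
  fixes g :: "nat \<Rightarrow> nat"
  assumes "\<forall>\<^sub>F i in sequentially. P i" "\<not> bdd_above (range g)"
  shows "\<exists>i. P i \<and> K \<le> g i"
proof (rule ccontr)
  assume none: "\<not> ?thesis"
  obtain i0 where i0: "\<forall>i\<ge>i0. P i" using assms(1) by (auto simp: eventually_sequentially)
  have "g i \<in> g ` {..<i0} \<union> {..K}" for i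
    using none i0 by (cases "i < i0") (auto simp: not_less not_le intro: less_imp_le)
  then have "finite (range g)" by (intro finite_subset[of "range g" "g ` {..<i0} \<union> {..K}"]) auto
  then show False using assms(2) by (simp add: bdd_above_nat)
qed

lemma arithmetic_rank_one_staircases:
  assumes "arithmetic_rank_one r s C"
  obtains \<tau> where "0 < \<tau>"
    "\<And>N K. \<exists>n a k m. N \<le> n \<and> K \<le> real (r n) \<and> \<tau> * real (r n) < real m \<and>
      staircase_set (height (C n)) a k m \<subseteq> height_set r s C n"
proof -
  obtain idx a k m \<tau> where idx: "filterlim idx at_top sequentially" and "\<tau> > 0"
    and stair: "\<And>i. staircase_set (height (C (idx i))) (a (idx i)) (k (idx i)) (m (idx i))
             \<subseteq> height_set r s C (idx i)"
    and long: "\<And>i. \<tau> < real (m (idx i)) / real (r (idx i))"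
    and unbounded: "\<not> bdd_above (range (\<lambda>i. r (idx i)))"
    using assms unfolding arithmetic_rank_one_def by (elim exE conjE) (rule that, auto)
  have "\<exists>n a k m. N \<le> n \<and> K \<le> real (r n) \<and> \<tau> * real (r n) < real m \<and>
      staircase_set (height (C n)) a k m \<subseteq> height_set r s C n" for N K
  proof -
    have "\<forall>\<^sub>F i in sequentially. N \<le> idx i" using idx by (simp add: filterlim_at_top)
    then obtain i where i: "N \<le> idx i" "nat \<lceil>K\<rceil> \<le> r (idx i)"
      using ex_ge_if_not_bdd_above[OF _ unbounded] by blast
    have "0 < r (idx i)"
      using assms rank_one.cuts[of r s C "idx i"] by (simp add: arithmetic_rank_one_def)
    then have "\<tau> * real (r (idx i)) < real (m (idx i))"
      using long[of i] by (simp add: pos_less_divide_eq)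
    moreover have "K \<le> real (r (idx i))" using i(2) by linarith
    ultimately show ?thesis using i(1) stair[of i] by blast
  qed
  then show thesis using \<open>\<tau> > 0\<close> that by blast
qed

theorem proposition4p4:
  fixes r :: "nat \<Rightarrow> nat" and s :: "nat \<Rightarrow> nat \<Rightarrow> nat" and C :: "nat \<Rightarrow> column"
  assumes "arithmetic_rank_one r s C"
  shows "weak_doubly_ergodic (rank_one_measure C) (rank_one_map C)"
proof -
  interpret rank_one r s C using assms by (simp add: arithmetic_rank_one_def)
  obtain \<tau> where \<tau>: "0 < \<tau>" and staircases:
      "\<And>N K. \<exists>n a k m. N \<le> n \<and> K \<le> real (r n) \<and> \<tau> * real (r n) < real m \<and>
        staircase_set (h n) a k m \<subseteq> height_set r s C n"
    using arithmetic_rank_one_staircases[OF assms] by blast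
  show ?thesis
    unfolding weak_doubly_ergodic_def
  proof (intro ballI impI)
    fix A B assume A: "A \<in> sets M" "0 < emeasure M A" and B: "B \<in> sets M" "0 < emeasure M B"
    have "0 < \<tau> / 6" using \<tau> by simp
    then obtain N d where small: "\<forall>n\<ge>N. \<exists>i<h n. \<exists>j<h n. \<bar>real i - real j\<bar> = d \<and>
        deficit A (C n) i + deficit B (C n) j < \<tau> / 6"
      by (rule small_deficits_in_late_columns[OF A B])
    obtain n a k m where "N \<le> n" and r: "2 * (d + 1) / \<tau> \<le> real (r n)"
      and m: "\<tau> * real (r n) < real m" and stair: "staircase_set (h n) a k m \<subseteq> height_set r s C n"
      using staircases by blast
    obtain i j where ij: "i < h n" "j < h n" "\<bar>real i - real j\<bar> = d"
      "deficit A (C n) i + deficit B (C n) j < \<tau> / 6"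
      using small \<open>N \<le> n\<close> by blast
    have "3 * real (r n) * (deficit A (C n) i + deficit B (C n) j) \<le> 3 * real (r n) * (\<tau> / 6)"
      using ij(4) by (intro mult_left_mono) auto
    then have "3 * real (r n) * (deficit A (C n) i + deficit B (C n) j)
        + \<bar>real i - real j\<bar> + 1 < real m"
      using m r \<tau> ij(3) by (simp add: field_simps)
    then show "\<exists>t>0. 0 < emeasure M (A \<inter> ((T ^^ t) -` A \<inter> space M)) \<and>
        0 < emeasure M (B \<inter> ((T ^^ t) -` A \<inter> space M))"
      by (rule staircase_common_visit[OF A(1) B(1) ij(1,2) stair])
  qed
qed

end
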